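(* Let $\Lambda=M\mathbb Z^d$ be a Bravais lattice with $M\in SL(d)$ (real $d\times d$ matrices of determinant $1$) decomposed as $M=QDT$, with $Q\in SO(d)$, $D=\mathrm{diag}(c_1,\ldots,c_d)$, $c_i>0$, $\prod_{i=1}^dc_i=1$, and $T$ lower triangular with all diagonal entries equal to $1$. Then for any $u\in\mathbb R^d$ and any $\alpha>0$, $$\theta_{\Lambda+u}(\alpha)\ge\theta_{D(\mathbb Z+1/2)^d}(\alpha).$$ Furthermore, for $d\ge2$, the sequence of $d\times d$ matrices $A_k=\mathrm{diag}(1,\ldots,1,k,1/k)$, $k\ge1$, satisfies, for any $\alpha>0$, $$\lim_{k\to+\infty}\theta_{A_k(\mathbb Z+1/2)^d}(\alpha)=0.$$
   Context: For a countable set $\mathcal C\subset\mathbb R^d$ and $\alpha>0$, $\theta_{\mathcal C}(\alpha)=\sum_{p\in\mathcal C}e^{-\pi\alpha|p|^2}$. For a matrix $A$, $A(\mathbb Z+1/2)^d=\{A(n+(1/2,\ldots,1/2)):\ n\in\mathbb Z^d\}$. *)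

theory Defs
  imports "HOL-Analysis.Analysis"
begin

text \<open>
  The dimension $d$ is \<open>CARD('n)\<close>. Where the order of the coordinates matters (lower triangular
  matrices, the last two diagonal entries), the index type carries a linear order, which identifies
  it with $\{1 < \dots < d\}$. Vectors are columns, so $M\mathbb{Z}^d$ is the image of the integer
  vectors under \<open>(*v) M\<close>.
\<close>

text \<open>
  The theta function takes values in $[0,\infty]$: this makes it meaningful for every set,
  with value \<open>\<infinity>\<close> when the series diverges (a real-valued \<open>infsum\<close> would be \<open>0\<close> there).
\<close>

definition theta :: "(real ^ 'n) set \<Rightarrow> real \<Rightarrow> ennreal" where
  "theta C \<alpha> = (\<Sum>\<^sub>\<infinity>p\<in>C. ennreal (exp (- pi * \<alpha> * (norm p)\<^sup>2)))"

definition int_vecs :: "(real ^ 'n) set" where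
  "int_vecs = {n. \<forall>i. n $ i \<in> \<int>}"

definition lattice :: "real ^ 'n ^ 'n \<Rightarrow> (real ^ 'n) set" where
  "lattice M = (\<lambda>n. M *v n) ` int_vecs"

definition half_lattice :: "real ^ 'n ^ 'n \<Rightarrow> (real ^ 'n) set" where
  "half_lattice A = (\<lambda>n. A *v (n + (\<chi> i. 1/2))) ` int_vecs"

definition diag :: "('n \<Rightarrow> real) \<Rightarrow> real ^ 'n ^ 'n" where
  "diag c = (\<chi> i j. if i = j then c i else 0)"

definition unit_lower_triangular :: "real ^ 'n::{finite,linorder} ^ 'n::{finite,linorder} \<Rightarrow> bool" where
  "unit_lower_triangular T \<longleftrightarrow> (\<forall>i. T $ i $ i = 1) \<and> (\<forall>i j. i < j \<longrightarrow> T $ i $ j = 0)"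

text \<open>
  $\mathrm{diag}(1,\dots,1,k,1/k)$. The number of indices above \<open>i\<close> is \<open>0\<close> for the last coordinate
  and \<open>1\<close> for the last but one.
\<close>

definition A_mat :: "nat \<Rightarrow> real ^ 'n::{finite,linorder} ^ 'n::{finite,linorder}" where
  "A_mat k = diag (\<lambda>i. if card {i<..} = 0 then 1 / real k
                       else if card {i<..} = 1 then real k
                       else 1)"

end

theory Submission
  imports Defs
begin

text \<open>
  In one dimension the claim is that $f_a(s)=\sum_{n\in\mathbb Z}e^{-a(n+s)^2}$, called \<open>gauss a s\<close>
  below, is smallest at $s=\frac12$. The usual argument reads this off the Jacobi triple product after
  Poisson summation; the argument here is elementary. Multiplying two such sums and regrouping the index
  pairs $(m,n)$ by the parity of $m+n$ expresses a product of values of $f_a$ through values of $f_{2a}$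
  (\<open>gauss_product\<close>). Using this twice, together with the inequality of the means, gives
  \[ f_a(x)^4\ \ge\ f_a({\textstyle\frac12})^3\,f_a(2x+{\textstyle\frac12}) \]
  (\<open>gauss_quartic\<close>). Since $f_a$ is bounded below by a positive constant, its infimum $m$ satisfies
  $m^4\ge f_a(\frac12)^3m$, that is $m\ge f_a(\frac12)$ (\<open>gauss_half_minimal\<close>).

  In dimension $d$, the rotation $Q$ does not change norms, and because $T$ is unit lower triangular the
  squared norm of a point of the translated lattice is $\sum_ic_i^2(n_i+s_i)^2$ with $s_i$ depending only
  on the $n_j$ with $j<i$. Summing over the last coordinate first and applying the one-dimensional bound
  to each sum in turn (\<open>prod_gauss_half_le_triangular\<close>) shows that the theta function is at least
  $\prod_if_{\pi\alpha c_i^2}(\frac12)$, which is exactly the theta function of $D(\mathbb Z+\frac12)^d$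
  (\<open>theta_half_lattice_diag\<close>).

  The same product formula gives the limit. The vectors of $\mathbb Z+\frac12$ stay away from the
  origin, so stretching by $k$ makes one factor decay like a Gaussian in $k$
  (\<open>gauss_half_decay\<close>), whereas contracting by $k$ costs only a power of $k$
  (\<open>gauss_half_le\<close>).
\<close>

section \<open>Unconditional sums of extended nonnegative reals\<close>

lemma ennreal_summable_on:
  fixes f :: "'a \<Rightarrow> ennreal"
  shows "f summable_on A"
  by (rule nonneg_summable_on_complete) simp

lemma infsum_le_ennreal:
  fixes f :: "'a \<Rightarrow> ennreal"
  assumes "\<And>F. finite F \<Longrightarrow> F \<subseteq> A \<Longrightarrow> sum f F \<le> c"
  shows "infsum f A \<le> c"
  using assms by (auto simp: nonneg_infsum_complete intro!: SUP_least)

lemma sum_le_infsum_ennreal: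
  fixes f :: "'a \<Rightarrow> ennreal"
  assumes "finite F" "F \<subseteq> A"
  shows "sum f F \<le> infsum f A"
  using assms by (auto simp: nonneg_infsum_complete intro!: SUP_upper)

lemma infsum_mono_ennreal:
  fixes f g :: "'a \<Rightarrow> ennreal"
  assumes "\<And>x. x \<in> A \<Longrightarrow> f x \<le> g x"
  shows "infsum f A \<le> infsum g A"
  using assms by (intro infsum_mono ennreal_summable_on)

lemma infsum_cmult_ennreal:
  fixes f :: "'a \<Rightarrow> ennreal"
  shows "infsum (\<lambda>x. c * f x) A = c * infsum f A"
  by (simp add: nonneg_infsum_complete SUP_mult_left_ennreal sum_distrib_left)

lemma infsum_Times_finite_ennreal:
  fixes f :: "'a \<times> 'b \<Rightarrow> ennreal"
  assumes "finite X"
  shows "(\<Sum>x\<in>X. \<Sum>\<^sub>\<infinity>y\<in>B. f (x, y)) = infsum f (X \<times> B)"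
  using assms
proof (induction X)
  case (insert x X)
  have "infsum f ({x} \<times> B) = (\<Sum>\<^sub>\<infinity>y\<in>B. f (x, y))"
  proof -
    have "{x} \<times> B = Pair x ` B" by auto
    then show ?thesis
      using infsum_reindex[of "Pair x" B f] by (simp add: inj_on_def comp_def)
  qed
  moreover have "infsum f (insert x X \<times> B) = infsum f ({x} \<times> B) + infsum f (X \<times> B)"
    using insert by (subst infsum_Un_disjoint[symmetric]) (auto intro!: arg_cong[of _ _ "infsum f"] ennreal_summable_on)
  ultimately show ?case using insert by simp
qed simp

text \<open>
  Tonelli's theorem for unconditional sums: both sides are suprema of finite partial sums, and
  every finite subset of a product lies in a finite rectangle.
\<close>

lemma infsum_Times_ennreal:
  fixes f :: "'a \<times> 'b \<Rightarrow> ennreal"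
  shows "infsum f (A \<times> B) = (\<Sum>\<^sub>\<infinity>x\<in>A. \<Sum>\<^sub>\<infinity>y\<in>B. f (x, y))"
proof (rule antisym)
  show "infsum f (A \<times> B) \<le> (\<Sum>\<^sub>\<infinity>x\<in>A. \<Sum>\<^sub>\<infinity>y\<in>B. f (x, y))"
  proof (rule infsum_le_ennreal)
    fix F assume F: "finite F" "F \<subseteq> A \<times> B"
    have "sum f F \<le> sum f (fst ` F \<times> snd ` F)"
      using F by (intro sum_mono2) force+
    also have "\<dots> = (\<Sum>x\<in>fst ` F. \<Sum>y\<in>snd ` F. f (x, y))"
      by (simp add: sum.cartesian_product)
    also have "\<dots> \<le> (\<Sum>x\<in>fst ` F. \<Sum>\<^sub>\<infinity>y\<in>B. f (x, y))"
      using F by (intro sum_mono sum_le_infsum_ennreal) auto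
    also have "\<dots> \<le> (\<Sum>\<^sub>\<infinity>x\<in>A. \<Sum>\<^sub>\<infinity>y\<in>B. f (x, y))"
      using F by (intro sum_le_infsum_ennreal) auto
    finally show "sum f F \<le> (\<Sum>\<^sub>\<infinity>x\<in>A. \<Sum>\<^sub>\<infinity>y\<in>B. f (x, y))" .
  qed
  show "(\<Sum>\<^sub>\<infinity>x\<in>A. \<Sum>\<^sub>\<infinity>y\<in>B. f (x, y)) \<le> infsum f (A \<times> B)"
  proof (rule infsum_le_ennreal)
    fix X assume X: "finite X" "X \<subseteq> A"
    have "infsum f (X \<times> B) \<le> infsum f (A \<times> B)"
      using X by (intro infsum_mono_neutral ennreal_summable_on) auto
    then show "(\<Sum>x\<in>X. \<Sum>\<^sub>\<infinity>y\<in>B. f (x, y)) \<le> infsum f (A \<times> B)"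
      using X by (simp add: infsum_Times_finite_ennreal)
  qed
qed

lemma infsum_product_ennreal:
  fixes f :: "'a \<Rightarrow> ennreal" and g :: "'b \<Rightarrow> ennreal"
  shows "infsum f A * infsum g B = (\<Sum>\<^sub>\<infinity>(x, y)\<in>A \<times> B. f x * g y)"
  by (simp add: infsum_Times_ennreal infsum_cmult_ennreal mult.commute[of _ "infsum g B"])

text \<open>
  Summing out one coordinate while the others stay fixed. This is the induction step for every
  $d$-dimensional sum below.
\<close>

lemma infsum_PiE_insert_ennreal:
  fixes F :: "('i \<Rightarrow> 'b) \<Rightarrow> ennreal"
  assumes "b \<notin> S"
  shows "infsum F (PiE (insert b S) T) = (\<Sum>\<^sub>\<infinity>n\<in>PiE S T. \<Sum>\<^sub>\<infinity>k\<in>T b. F (n(b := k)))"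
proof -
  have "PiE (insert b S) T = (\<lambda>(n, k). n(b := k)) ` (PiE S T \<times> T b)"
    unfolding PiE_insert_eq
    by (subst swap_product [symmetric]) (simp add: image_image case_prod_unfold)
  then show ?thesis
    using infsum_reindex[OF inj_combinator'[OF assms], of F T]
    by (simp add: infsum_Times_ennreal comp_def)
qed

lemma infsum_prod_PiE_ennreal:
  fixes h :: "'i \<Rightarrow> 'b \<Rightarrow> ennreal"
  assumes "finite S"
  shows "(\<Sum>\<^sub>\<infinity>n\<in>PiE S T. \<Prod>i\<in>S. h i (n i)) = (\<Prod>i\<in>S. infsum (h i) (T i))"
  using assms
proof (induction S)
  case (insert b S)
  have [simp]: "(\<Prod>i\<in>S. h i (if i = b then k else n i)) = (\<Prod>i\<in>S. h i (n i))" for k n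
    using insert by (intro prod.cong) auto
  have "(\<Sum>\<^sub>\<infinity>n\<in>PiE (insert b S) T. \<Prod>i\<in>insert b S. h i (n i)) =
      (\<Sum>\<^sub>\<infinity>n\<in>PiE S T. infsum (h b) (T b) * (\<Prod>i\<in>S. h i (n i)))"
    using insert by (simp add: infsum_PiE_insert_ennreal infsum_cmult_ennreal
        mult.commute[of _ "prod _ _"])
  then show ?case
    using insert by (simp add: infsum_cmult_ennreal)
qed simp

section \<open>The one-dimensional periodized Gaussian\<close>

definition gauss :: "real \<Rightarrow> real \<Rightarrow> ennreal" where
  "gauss a s = (\<Sum>\<^sub>\<infinity>n::int. ennreal (exp (- a * (of_int n + s)\<^sup>2)))"

lemma gauss_reindex:
  assumes "bij h"
  shows "gauss a s = (\<Sum>\<^sub>\<infinity>n::int. ennreal (exp (- a * (of_int (h n) + s)\<^sup>2)))"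
  unfolding gauss_def
  using infsum_reindex_bij_betw[OF assms, of "\<lambda>n. ennreal (exp (- a * (of_int n + s)\<^sup>2))"] by simp

lemma gauss_add_1: "gauss a (s + 1) = gauss a s"
proof -
  have "bij (\<lambda>n::int. n + 1)"
    by (rule bij_betwI[where g = "\<lambda>n. n - 1"]) auto
  from gauss_reindex[OF this] show ?thesis by (simp add: gauss_def add_ac)
qed

lemma gauss_minus: "gauss a (- s) = gauss a s"
proof -
  have "bij (uminus :: int \<Rightarrow> int)"
    by (rule bij_betwI[where g = uminus]) auto
  from gauss_reindex[OF this, of a s] have "gauss a s =
     (\<Sum>\<^sub>\<infinity>n::int. ennreal (exp (- a * (of_int (- n) + s)\<^sup>2)))" .
  moreover have "(of_int (- n) + s)\<^sup>2 = (of_int n + - s)\<^sup>2" for n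
    by (simp add: power2_eq_square algebra_simps)
  ultimately show ?thesis by (simp only: gauss_def)
qed

text \<open>
  The parallelogram identity $(m+x)^2+(n+y)^2=\frac12\big((m+n+x+y)^2+(m-n+x-y)^2\big)$ turns a
  product of two sums into sums over the pairs $(m+n,m-n)$. These are exactly the pairs of integers
  of equal parity, and each parity class $e\in\{0,1\}$ gives one product on the right.
\<close>

lemma gauss_product:
  "gauss a x * gauss a y =
     gauss (2 * a) ((x + y) / 2) * gauss (2 * a) ((x - y) / 2) +
     gauss (2 * a) ((x + y + 1) / 2) * gauss (2 * a) ((x - y + 1) / 2)"
proof -
  define w where "w = (\<lambda>(m::int, n::int).
    ennreal (exp (- a * (of_int m + x)\<^sup>2)) * ennreal (exp (- a * (of_int n + y)\<^sup>2)))"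
  \<comment> \<open>The pairs $(m,n)$ with $m+n\equiv e$ modulo $2$, written with $m+n=2k+e$ and $m-n=2l+e$.\<close>
  define h where "h = (\<lambda>e::int. \<lambda>(k::int, l::int). (k + l + e, k - l))"
  have inj: "inj (h e)" for e
    by (auto simp: h_def inj_on_def)
  have disj: "range (h 0) \<inter> range (h 1) = {}"
  proof -
    have "even (fst p + snd p)" if "p \<in> range (h 0)" for p
      using that by (auto simp: h_def)
    moreover have "odd (fst p + snd p)" if "p \<in> range (h 1)" for p
      using that by (auto simp: h_def)
    ultimately show ?thesis by blast
  qed
  have cover: "range (h 0) \<union> range (h 1) = UNIV"
  proof -
    have "(m, n) \<in> range (h 0) \<union> range (h 1)" for m n
    proof (cases "even (m + n)")
      case True
      then have "(m, n) = h 0 ((m + n) div 2, (m - n) div 2)"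
        unfolding h_def by auto presburger+
      then show ?thesis by blast
    next
      case False
      then have "(m, n) = h 1 ((m + n) div 2, (m - n) div 2)"
        unfolding h_def by auto presburger+
      then show ?thesis by blast
    qed
    then show ?thesis by auto
  qed
  have part: "infsum w (range (h e)) =
      gauss (2 * a) ((x + y + of_int e) / 2) * gauss (2 * a) ((x - y + of_int e) / 2)" for e
  proof -
    have "w (h e (k, l)) = ennreal (exp (- (2 * a) * (of_int k + (x + y + of_int e) / 2)\<^sup>2)) *
       ennreal (exp (- (2 * a) * (of_int l + (x - y + of_int e) / 2)\<^sup>2))" for k l
      unfolding w_def h_def
      by (simp flip: ennreal_mult exp_add add: power2_eq_square field_simps)
    then show ?thesis
      unfolding gauss_def infsum_product_ennreal
      by (simp add: infsum_reindex[OF inj] comp_def case_prod_unfold)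
        (metis (no_types, lifting) prod.collapse)
  qed
  have "gauss a x * gauss a y = infsum w UNIV"
    unfolding gauss_def infsum_product_ennreal w_def by simp
  also have "\<dots> = infsum w (range (h 0)) + infsum w (range (h 1))"
    using infsum_Un_disjoint[OF ennreal_summable_on ennreal_summable_on disj, of w] by (simp only: cover)
  finally show ?thesis by (simp add: part)
qed

lemma gauss_split_parity:
  "gauss a (2 * z) = gauss (4 * a) z + gauss (4 * a) (z + 1 / 2)"
proof -
  define w where "w = (\<lambda>n::int. ennreal (exp (- a * (of_int n + 2 * z)\<^sup>2)))"
  have cover: "range (\<lambda>n::int. 2 * n) \<union> range (\<lambda>n::int. 2 * n + 1) = UNIV"
  proof -
    have "n \<in> range (\<lambda>n::int. 2 * n) \<union> range (\<lambda>n::int. 2 * n + 1)" for n :: int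
      by (cases "even n") (auto elim!: evenE oddE)
    then show ?thesis by auto
  qed
  have "gauss a (2 * z) = infsum w UNIV"
    unfolding gauss_def w_def by simp
  also have "\<dots> = infsum w (range (\<lambda>n::int. 2 * n)) + infsum w (range (\<lambda>n::int. 2 * n + 1))"
  proof -
    have "range (\<lambda>n::int. 2 * n) \<inter> range (\<lambda>n::int. 2 * n + 1) = {}"
      by (auto, presburger)
    from infsum_Un_disjoint[OF ennreal_summable_on ennreal_summable_on this, of w] show ?thesis
      by (simp only: cover)
  qed
  also have "infsum w (range (\<lambda>n::int. 2 * n)) = gauss (4 * a) z"
    by (subst infsum_reindex)
      (auto simp: inj_on_def gauss_def w_def power2_eq_square algebra_simps intro!: infsum_cong)
  also have "infsum w (range (\<lambda>n::int. 2 * n + 1)) = gauss (4 * a) (z + 1 / 2)"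
    by (subst infsum_reindex)
      (auto simp: inj_on_def gauss_def w_def power2_eq_square algebra_simps intro!: infsum_cong)
  finally show ?thesis .
qed

text \<open>
  The estimate $e^{-x}\le 1/x$ bounds the sum by a convergent series. The resulting order $1/a$ is
  coarser than the true order $a^{-1/2}$ as $a\to0$, but a power of $a$ is all that matters when it
  is multiplied by the exponential factor of \<open>gauss_half_decay\<close>.
\<close>

lemma gauss_half_le:
  obtains K where "K > 0" "\<And>a. a > 0 \<Longrightarrow> gauss a (1 / 2) \<le> ennreal (K / a)"
proof -
  define r where "r = (\<lambda>n. inverse (real (Suc n) ^ 2))"
  have r: "r summable_on UNIV"
    unfolding r_def
    using inverse_power_summable[of 2, where 'a = real]
    by (intro summable_nonneg_imp_summable_on) (subst summable_Suc_iff, auto)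
  define K where "K = infsum r UNIV"
  have K0: "K \<ge> 0"
    unfolding K_def by (intro infsum_nonneg) (auto simp: r_def)
  have K: "(\<Sum>\<^sub>\<infinity>n. ennreal (r n)) = ennreal K"
    unfolding K_def
    using r by (subst infsum_comm_additive_general[where f = ennreal, unfolded comp_def])
       (auto simp: r_def)
  have "gauss a (1 / 2) \<le> ennreal ((8 * K + 1) / a)" if a: "a > 0" for a
  proof -
    define w where "w = (\<lambda>n::int. ennreal (exp (- a * (of_int n + 1 / 2)\<^sup>2)))"
    have cover: "range int \<union> range (\<lambda>n. - 1 - int n) = UNIV"
    proof -
      have "n \<in> range int \<union> range (\<lambda>n. - 1 - int n)" for n
        by (cases n rule: int_cases) (auto simp: image_iff)
      then show ?thesis by auto
    qed
    have *: "w (int n) \<le> ennreal (4 / a) * ennreal (r n)" for n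
    proof -
      have "exp (- a * (of_int (int n) + 1 / 2)\<^sup>2) \<le> 1 / (a * (real n + 1 / 2)\<^sup>2)"
      proof -
        have "a * (real n + 1 / 2)\<^sup>2 \<le> exp (a * (real n + 1 / 2)\<^sup>2)"
          using exp_ge_add_one_self[of "a * (real n + 1 / 2)\<^sup>2"] by linarith
        moreover have "a * (real n + 1 / 2)\<^sup>2 > 0" using a by auto
        ultimately show ?thesis
          by (simp add: exp_minus divide_simps)
      qed
      also have "\<dots> \<le> 4 / a * r n"
      proof -
        have "((real n + 1) / 2)\<^sup>2 \<le> (real n + 1 / 2)\<^sup>2"
          by (intro power_mono) auto
        then have "1 / (a * (real n + 1 / 2)\<^sup>2) \<le> 1 / (a * ((real n + 1) / 2)\<^sup>2)"
          using a by (intro divide_left_mono mult_left_mono) auto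
        then show ?thesis by (simp add: r_def power_divide divide_simps add_ac)
      qed
      finally show ?thesis
        using a by (simp add: w_def r_def flip: ennreal_mult)
    qed
    have sym: "w (- 1 - int n) = w (int n)" for n
      by (simp add: w_def power2_eq_square algebra_simps)
    have "gauss a (1 / 2) = infsum w (range int) + infsum w (range (\<lambda>n. - 1 - int n))"
    proof -
      have "range int \<inter> range (\<lambda>n. - 1 - int n) = {}"
        by auto
      from infsum_Un_disjoint[OF ennreal_summable_on ennreal_summable_on this, of w] show ?thesis
        by (simp only: cover gauss_def w_def)
    qed
    also have "\<dots> = (\<Sum>\<^sub>\<infinity>n. w (int n)) + (\<Sum>\<^sub>\<infinity>n. w (int n))"
      by (subst (1 2) infsum_reindex) (auto simp: inj_on_def comp_def sym)
    also have "\<dots> \<le> ennreal (4 / a * K) + ennreal (4 / a * K)"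
    proof -
      have "(\<Sum>\<^sub>\<infinity>n. w (int n)) \<le> (\<Sum>\<^sub>\<infinity>n. ennreal (4 / a) * ennreal (r n))"
        by (intro infsum_mono_ennreal *)
      also have "\<dots> = ennreal (4 / a * K)"
        using a K0 by (simp add: infsum_cmult_ennreal K flip: ennreal_mult)
      finally show ?thesis by (intro add_mono)
    qed
    also have "\<dots> \<le> ennreal ((8 * K + 1) / a)"
      using a K0 by (subst ennreal_plus[symmetric]) (auto simp: field_simps intro!: ennreal_leI)
    finally show ?thesis .
  qed
  then show ?thesis using that[of "8 * K + 1"] K0 by simp
qed

text \<open>
  Reduction to the shift $1/2$, since $(n+s)^2+(s-\frac12)^2\ge\frac12(n+\frac12)^2$.
\<close>

lemma gauss_finite:
  assumes "a > 0"
  shows "gauss a s < \<infinity>"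
proof -
  obtain K where K: "K > 0" "\<And>a. a > 0 \<Longrightarrow> gauss a (1 / 2) \<le> ennreal (K / a)"
    using gauss_half_le by metis
  let ?c = "exp (a * (s - 1 / 2)\<^sup>2)"
  have "exp (- a * (of_int n + s)\<^sup>2) \<le> ?c * exp (- (a / 2) * (of_int n + 1 / 2)\<^sup>2)" for n :: int
  proof -
    have "(of_int n + 1 / 2)\<^sup>2 / 2 \<le> (of_int n + s)\<^sup>2 + (s - 1 / 2)\<^sup>2"
    proof -
      have "(of_int n + s)\<^sup>2 + (s - 1 / 2)\<^sup>2 - (of_int n + 1 / 2)\<^sup>2 / 2 =
          (of_int n + 1 / 2 + 2 * (s - 1 / 2))\<^sup>2 / 2"
        by (simp add: power2_eq_square field_simps)
      then show ?thesis
        using zero_le_power2[of "of_int n + 1 / 2 + 2 * (s - 1 / 2)"] by linarith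
    qed
    from mult_left_mono[OF this, of a] assms show ?thesis
      by (simp flip: exp_add add: algebra_simps)
  qed
  then have "gauss a s \<le> (\<Sum>\<^sub>\<infinity>n::int. ennreal ?c * ennreal (exp (- (a / 2) * (of_int n + 1 / 2)\<^sup>2)))"
    unfolding gauss_def
    by (intro infsum_mono_ennreal) (simp flip: ennreal_mult)
  also have "\<dots> = ennreal ?c * gauss (a / 2) (1 / 2)"
    by (simp add: infsum_cmult_ennreal gauss_def)
  also have "\<dots> \<le> ennreal ?c * ennreal (K / (a / 2))"
    using assms by (intro mult_left_mono K(2)) auto
  also have "\<dots> < \<infinity>"
    by (simp add: ennreal_mult_less_top)
  finally show ?thesis .
qed

text \<open>
  Some integer translate of $s$ lies within $1/2$ of the origin, and its term alone is this large.
  The point of the bound is its uniformity in $s$.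
\<close>

lemma gauss_ge:
  assumes "a > 0"
  shows "ennreal (exp (- a / 4)) \<le> gauss a s"
proof -
  \<comment> \<open>The index that brings $n+s$ closest to the origin.\<close>
  define n where "n = - round s"
  have "\<bar>of_int n + s\<bar> \<le> 1 / 2"
    using of_int_round_abs_le[of s] by (simp add: n_def abs_minus_commute)
  then have "(of_int n + s)\<^sup>2 \<le> (1 / 2)\<^sup>2"
    by (intro power2_le_iff_abs_le[THEN iffD2]) auto
  then have "ennreal (exp (- a / 4)) \<le> ennreal (exp (- a * (of_int n + s)\<^sup>2))"
    using assms by (intro ennreal_leI) (simp add: power_divide)
  also have "\<dots> \<le> gauss a s"
    using sum_le_infsum_ennreal[of "{n}" UNIV "\<lambda>n. ennreal (exp (- a * (of_int n + s)\<^sup>2))"]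
    by (simp add: gauss_def)
  finally show ?thesis .
qed

text \<open>
  Write $f_b$ for \<open>gauss b\<close> and $F=f_{2a}$. The product identity gives
  $f_a(x)^2=F(x)F(0)+F(x+\frac12)F(\frac12)$, so by the inequality of the means
  $f_a(x)^4\ge4\,F(x)F(x+\frac12)\cdot F(0)F(\frac12)$. A second application, to $F(x)F(x+\frac12)$,
  brings in $f_{4a}$, and the splitting by parity collects its two terms into a value of $f_a$ again:
  $F(x)F(x+\frac12)=f_{4a}(\frac14)\,f_a(2x+\frac12)$. The factor $f_{4a}(\frac14)$ is eliminated
  through $f_a(\frac12)^2=2\,F(0)F(\frac12)$, which makes it $\frac12f_a(\frac12)$. The inequality therefore relates $f_a$ at $x$
  to the same function at $2x+\frac12$.
\<close>

lemma gauss_quartic: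
  assumes a: "a > 0"
  shows "enn2real (gauss a (1 / 2)) ^ 3 * enn2real (gauss a (2 * x + 1 / 2)) \<le> enn2real (gauss a x) ^ 4"
proof -
  define F where "F = (\<lambda>b s. enn2real (gauss b s))"
  have F: "gauss b s = ennreal (F b s)" "F b s \<ge> 0" if "b > 0" for b s
    using gauss_finite[OF that, of s] by (auto simp: F_def ennreal_enn2real_if)
  have per: "F b (s + 1) = F b s" and sym: "F b (- s) = F b s" for b s
    by (simp_all only: F_def gauss_add_1 gauss_minus)
  have prod: "F b u * F b v = F (2 * b) ((u + v) / 2) * F (2 * b) ((u - v) / 2) +
     F (2 * b) ((u + v + 1) / 2) * F (2 * b) ((u - v + 1) / 2)" if "b > 0" for b u v
    using gauss_product[of b u v] that F
    by (simp flip: ennreal_mult ennreal_plus add: F)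
  have landen: "F (2 * a) z * F (2 * a) (z + 1 / 2) = F (4 * a) (1 / 4) * F a (2 * z + 1 / 2)" for z
  proof -
    have "F (2 * a) z * F (2 * a) (z + 1 / 2) =
      F (4 * a) (z + 1 / 4) * F (4 * a) (- (1 / 4)) + F (4 * a) (z + 3 / 4) * F (4 * a) (1 / 4)"
      using prod[of "2 * a" z "z + 1 / 2"] a by (simp add: field_simps)
    also have "\<dots> = F (4 * a) (1 / 4) * (F (4 * a) (z + 1 / 4) + F (4 * a) (z + 3 / 4))"
      by (simp only: sym) (simp add: algebra_simps)
    also have "F (4 * a) (z + 1 / 4) + F (4 * a) (z + 3 / 4) = F a (2 * z + 1 / 2)"
      using gauss_split_parity[of a "z + 1 / 4"] a
      by (simp flip: ennreal_plus add: F algebra_simps)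
    finally show ?thesis .
  qed
  define A where "A = F (2 * a) 0"
  define B where "B = F (2 * a) (1 / 2)"
  define X where "X = F (2 * a) x"
  define Y where "Y = F (2 * a) (x + 1 / 2)"
  define G where "G = F (4 * a) (1 / 4)"
  have AB: "A * B = G * F a (1 / 2)"
    using landen[of 0] by (simp add: A_def B_def G_def)
  have XY: "X * Y = G * F a (2 * x + 1 / 2)"
    using landen[of x] by (simp add: X_def Y_def G_def)
  have sq: "F a x ^ 2 = X * A + Y * B"
    using prod[of a x x] a by (simp add: A_def B_def X_def Y_def power2_eq_square add_divide_distrib)
  have "F a (1 / 2) ^ 2 = B * A + F (2 * a) (0 + 1) * B"
    using prod[of a "1 / 2" "1 / 2"] a by (simp add: A_def B_def power2_eq_square)
  then have half: "F a (1 / 2) ^ 2 = 2 * (G * F a (1 / 2))"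
    unfolding per AB[symmetric] by (simp add: A_def)
  have pos: "F a (1 / 2) > 0"
    using gauss_ge[OF a, of "1 / 2"] F[OF a, of "1 / 2"]
    by (simp add: less_le_trans[OF exp_gt_zero])
  have G: "F a (1 / 2) = 2 * G"
    using half pos by (simp add: power2_eq_square)
  have "F a (1 / 2) ^ 3 * F a (2 * x + 1 / 2) = 4 * (X * Y) * (A * B)"
    unfolding XY AB by (simp add: G power3_eq_cube)
  also have "\<dots> \<le> (X * A + Y * B) ^ 2"
    using sum_power2_ge_zero[of "X * A - Y * B" 0] by (simp add: power2_eq_square algebra_simps)
  also have "\<dots> = F a x ^ 4"
    unfolding sq[symmetric] by simp
  finally show ?thesis by (simp add: F_def)
qed

text \<open>
  Let $h=f_a(\frac12)$ and let $m>0$ be the infimum of $f_a$. The quartic inequality gives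
  $f_a(x)^4\ge h^3m$ for every $x$, hence $m^4\ge h^3m$, and so $m\ge h$. Positivity of $m$ is what
  allows the cancellation.
\<close>

lemma gauss_half_minimal:
  assumes a: "a > 0"
  shows "gauss a (1 / 2) \<le> gauss a s"
proof -
  define F where "F = (\<lambda>s. enn2real (gauss a s))"
  have F: "gauss a s = ennreal (F s)" "F s \<ge> 0" for s
    using gauss_finite[OF a, of s] by (auto simp: F_def ennreal_enn2real_if)
  have ge: "exp (- a / 4) \<le> F s" for s
    using gauss_ge[OF a, of s] by (simp add: F)
  define h where "h = F (1 / 2)"
  define m where "m = (INF s. F s)"
  have h: "h > 0" using ge[of "1 / 2"] by (simp add: h_def less_le_trans[OF exp_gt_zero])
  have bdd: "bdd_below (range F)" using ge by (intro bdd_belowI2)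
  have m_le: "m \<le> F s" for s
    unfolding m_def using bdd by (intro cINF_lower) auto
  have "exp (- a / 4) \<le> m"
    unfolding m_def using ge by (intro cINF_greatest) auto
  then have m: "m > 0" by (simp add: less_le_trans[OF exp_gt_zero])
  have "root 4 (h ^ 3 * m) \<le> F s" for s
  proof -
    have "h ^ 3 * m \<le> h ^ 3 * F (2 * s + 1 / 2)"
      using h by (intro mult_left_mono m_le) auto
    also have "\<dots> \<le> F s ^ 4"
      using gauss_quartic[OF a, of s] by (simp add: F_def h_def)
    finally have "root 4 (h ^ 3 * m) \<le> root 4 (F s ^ 4)"
      by simp
    then show ?thesis using F(2)[of s] by (simp add: real_root_power_cancel)
  qed
  then have "root 4 (h ^ 3 * m) \<le> m"
    unfolding m_def by (intro cINF_greatest) auto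
  then have "root 4 (h ^ 3 * m) ^ 4 \<le> m ^ 4"
    using h m by (intro power_mono) auto
  then have "h ^ 3 * m \<le> m ^ 3 * m"
    using h m by (simp add: real_root_pow_pos2 power_Suc2[symmetric] del: power_Suc)
  then have "h ^ 3 \<le> m ^ 3" using m by simp
  then have "h \<le> m" using m h power_less_imp_less_base power_mono_iff[of h m 3] by simp
  also have "m \<le> F s" by (rule m_le)
  finally show ?thesis by (simp add: F h_def)
qed

section \<open>Translated lattices\<close>

text \<open>
  The shift of each coordinate depends on the smaller coordinates only. The largest coordinate
  can therefore be summed out first, for fixed values of the others: this is a one-dimensional sum
  with a constant shift, to which minimality at $1/2$ applies, and the remaining sum has the same shape.
\<close>

lemma prod_gauss_half_le_triangular:
  fixes s :: "'i::linorder \<Rightarrow> ('i \<Rightarrow> int) \<Rightarrow> real"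
  assumes "finite S" and "\<And>i. i \<in> S \<Longrightarrow> a i > 0"
    and s: "\<And>i n m. (\<And>j. j < i \<Longrightarrow> n j = m j) \<Longrightarrow> s i n = s i m"
  shows "(\<Prod>i\<in>S. gauss (a i) (1 / 2)) \<le>
    (\<Sum>\<^sub>\<infinity>n\<in>PiE S (\<lambda>_. UNIV). \<Prod>i\<in>S. ennreal (exp (- a i * (of_int (n i) + s i n)\<^sup>2)))"
  using assms(1,2)
proof (induction S rule: finite_linorder_max_induct)
  case (insert b S)
  let ?w = "\<lambda>i n. ennreal (exp (- a i * (of_int (n i) + s i n)\<^sup>2))"
  have "b \<notin> S" using insert by auto
  have inner: "(\<Sum>\<^sub>\<infinity>k. \<Prod>i\<in>insert b S. ?w i (n(b := k))) = gauss (a b) (s b n) * (\<Prod>i\<in>S. ?w i n)" for n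
  proof -
    have "?w i (n(b := k)) = ?w i n" if "i \<in> S" for i k
    proof -
      have "s i (n(b := k)) = s i n"
        using insert that by (intro s) auto
      then show ?thesis using that \<open>b \<notin> S\<close> by auto
    qed
    then have "(\<Prod>i\<in>S. ?w i (n(b := k))) = (\<Prod>i\<in>S. ?w i n)" for k
      by (intro prod.cong) auto
    moreover have "s b (n(b := k)) = s b n" for k
      by (intro s) auto
    ultimately show ?thesis
      using insert.hyps \<open>b \<notin> S\<close>
      by (simp add: gauss_def mult.commute[of _ "prod _ _"] infsum_cmult_ennreal)
  qed
  have "(\<Prod>i\<in>insert b S. gauss (a i) (1 / 2)) \<le> gauss (a b) (1 / 2) *
     (\<Sum>\<^sub>\<infinity>n\<in>PiE S (\<lambda>_. UNIV). \<Prod>i\<in>S. ?w i n)"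
    using insert \<open>b \<notin> S\<close> by (simp add: mult_left_mono)
  also have "\<dots> = (\<Sum>\<^sub>\<infinity>n\<in>PiE S (\<lambda>_. UNIV). gauss (a b) (1 / 2) * (\<Prod>i\<in>S. ?w i n))"
    by (simp add: infsum_cmult_ennreal)
  also have "\<dots> \<le> (\<Sum>\<^sub>\<infinity>n\<in>PiE S (\<lambda>_. UNIV). gauss (a b) (s b n) * (\<Prod>i\<in>S. ?w i n))"
    using insert.prems by (intro infsum_mono_ennreal mult_right_mono gauss_half_minimal) auto
  also have "\<dots> = (\<Sum>\<^sub>\<infinity>n\<in>PiE (insert b S) (\<lambda>_. UNIV). \<Prod>i\<in>insert b S. ?w i n)"
    by (subst infsum_PiE_insert_ennreal[OF \<open>b \<notin> S\<close>]) (simp only: inner)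
  finally show ?case .
qed simp

lemma theta_image_int_vecs:
  fixes g :: "real ^ 'n \<Rightarrow> real ^ 'n"
  assumes "inj g"
  shows "theta (g ` int_vecs) \<alpha> =
    (\<Sum>\<^sub>\<infinity>n. ennreal (exp (- pi * \<alpha> * (norm (g (\<chi> i. of_int (n i))))\<^sup>2)))"
proof -
  have int: "int_vecs = range (\<lambda>n::'n \<Rightarrow> int. \<chi> i. real_of_int (n i))"
  proof -
    have "x \<in> range (\<lambda>n::'n \<Rightarrow> int. \<chi> i. real_of_int (n i))" if "x \<in> int_vecs" for x
    proof -
      have "x $ i = of_int \<lfloor>x $ i\<rfloor>" for i
      proof -
        have "x $ i \<in> \<int>" using that by (simp add: int_vecs_def)
        then show ?thesis by (metis Ints_cases floor_of_int)
      qed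
      then have "x = (\<chi> i. of_int \<lfloor>x $ i\<rfloor>)"
        by (subst vec_eq_iff) simp
      then show ?thesis by (rule range_eqI[where x = "\<lambda>i. \<lfloor>x $ i\<rfloor>"])
    qed
    moreover have "(\<chi> i. real_of_int (n i)) \<in> int_vecs" for n :: "'n \<Rightarrow> int"
      by (simp add: int_vecs_def)
    ultimately show ?thesis by blast
  qed
  have "inj (\<lambda>n::'n \<Rightarrow> int. g (\<chi> i. real_of_int (n i)))"
  proof (rule injI)
    fix m n :: "'n \<Rightarrow> int"
    assume "g (\<chi> i. real_of_int (m i)) = g (\<chi> i. real_of_int (n i))"
    then have "(\<chi> i. real_of_int (m i)) = (\<chi> i. real_of_int (n i))"
      by (rule injD[OF assms])
    then show "m = n" by (simp add: vec_eq_iff fun_eq_iff)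
  qed
  from infsum_reindex[OF this] show ?thesis
    by (simp only: theta_def int image_image comp_def)
qed

lemma exp_neg_norm_squared:
  fixes x :: "real ^ 'n"
  shows "ennreal (exp (- b * (norm x)\<^sup>2)) = (\<Prod>i\<in>UNIV. ennreal (exp (- b * (x $ i)\<^sup>2)))"
proof -
  have "(norm x)\<^sup>2 = (\<Sum>i\<in>UNIV. (x $ i)\<^sup>2)"
    by (simp add: norm_vec_def L2_set_def sum_nonneg)
  then show ?thesis
    by (simp add: sum_distrib_left exp_sum prod_ennreal flip: sum_negf)
qed

lemma diag_mult_vec: "(diag c *v x) $ i = c i * x $ i"
  by (simp add: diag_def matrix_vector_mult_def if_distrib[of "\<lambda>x. x * _"] cong: if_cong)

lemma theta_half_lattice_diag:
  fixes c :: "'n::finite \<Rightarrow> real"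
  assumes "\<And>i. c i > 0"
  shows "theta (half_lattice (diag c)) \<alpha> = (\<Prod>i\<in>UNIV. gauss (pi * \<alpha> * (c i)\<^sup>2) (1 / 2))"
proof -
  have inj: "inj (\<lambda>n. diag c *v (n + (\<chi> i. 1 / 2)))"
    using assms by (auto simp: inj_def vec_eq_iff diag_mult_vec less_imp_neq[THEN not_sym])
  have weight: "ennreal (exp (- pi * \<alpha> * (norm (diag c *v ((\<chi> i. of_int (n i)) + (\<chi> i. 1 / 2))))\<^sup>2)) =
      (\<Prod>i\<in>UNIV. ennreal (exp (- (pi * \<alpha> * (c i)\<^sup>2) * (of_int (n i) + 1 / 2)\<^sup>2)))" for n
    using exp_neg_norm_squared[of "pi * \<alpha>" "diag c *v ((\<chi> i. of_int (n i)) + (\<chi> i. 1 / 2))"]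
    by (simp add: diag_mult_vec power_mult_distrib mult.assoc)
  have "theta (half_lattice (diag c)) \<alpha> = (\<Sum>\<^sub>\<infinity>n. \<Prod>i\<in>UNIV.
      ennreal (exp (- (pi * \<alpha> * (c i)\<^sup>2) * (of_int (n i) + 1 / 2)\<^sup>2)))"
    by (simp only: half_lattice_def theta_image_int_vecs[OF inj] weight)
  also have "\<dots> = (\<Prod>i\<in>UNIV. gauss (pi * \<alpha> * (c i)\<^sup>2) (1 / 2))"
    using infsum_prod_PiE_ennreal[of UNIV "\<lambda>i k. ennreal (exp (- (pi * \<alpha> * (c i)\<^sup>2) * (of_int k + 1 / 2)\<^sup>2))" "\<lambda>_. UNIV"]
    by (simp add: gauss_def PiE_UNIV_domain)
  finally show ?thesis .
qed

text \<open>
  The rotation $Q$ preserves norms, so it may be moved to the translation vector. In the coordinates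
  of $n$, the $i$-th entry of $DTn+Q^{T}u$ is then $c_i$ times $n_i$ plus a shift in which only the
  $n_j$ with $j<i$ occur.
\<close>

lemma theta_lattice_ge:
  fixes M Q T :: "real ^ 'n::{finite,linorder} ^ 'n::{finite,linorder}"
  assumes "det M \<noteq> 0" and Q: "orthogonal_matrix Q" and c: "\<And>i. c i > 0"
    and T: "unit_lower_triangular T" and M: "M = Q ** diag c ** T" and \<alpha>: "\<alpha> > 0"
  shows "theta (half_lattice (diag c)) \<alpha> \<le> theta ((\<lambda>x. x + u) ` lattice M) \<alpha>"
proof -
  define v where "v = transpose Q *v u"
  define s where "s = (\<lambda>i (n :: 'n \<Rightarrow> int). (\<Sum>j\<in>{..<i}. T $ i $ j * of_int (n j)) + v $ i / c i)"
  define vec where "vec = (\<lambda>n :: 'n \<Rightarrow> int. \<chi> i. real_of_int (n i))"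
  have norm: "norm (M *v x + u) = norm (diag c *v (T *v x) + v)" for x
  proof -
    have "Q *v v = u"
      using Q by (simp only: v_def matrix_vector_mul_assoc orthogonal_matrix_def matrix_vector_mul_lid)
    then have "Q *v (diag c *v (T *v x) + v) = M *v x + u"
      by (simp add: M matrix_vector_right_distrib matrix_vector_mul_assoc matrix_mul_assoc)
    moreover have "orthogonal_transformation ((*v) Q)"
      using Q by (simp add: orthogonal_transformation_matrix)
    ultimately show ?thesis
      by (metis orthogonal_transformation_norm)
  qed
  have comp: "(diag c *v (T *v vec n) + v) $ i = c i * (of_int (n i) + s i n)" for n i
  proof -
    have "(T *v vec n) $ i = (\<Sum>j\<in>UNIV. T $ i $ j * of_int (n j))"
      by (simp add: matrix_vector_mult_def vec_def)
    also have "\<dots> = (\<Sum>j\<in>insert i {..<i}. T $ i $ j * of_int (n j))"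
    proof (rule sum.mono_neutral_right)
      show "\<forall>j\<in>UNIV - insert i {..<i}. T $ i $ j * of_int (n j) = 0"
      proof
        fix j assume "j \<in> UNIV - insert i {..<i}"
        then have "i < j" by auto
        then show "T $ i $ j * of_int (n j) = 0"
          using T by (simp add: unit_lower_triangular_def)
      qed
    qed auto
    also have "\<dots> = of_int (n i) + (\<Sum>j\<in>{..<i}. T $ i $ j * of_int (n j))"
      using T by (simp add: unit_lower_triangular_def)
    finally show ?thesis
      using c[of i] by (simp add: diag_mult_vec s_def field_simps)
  qed
  have "inj ((*v) M)"
    using assms(1) by (simp add: inj_matrix_vector_mult invertible_det_nz)
  then have inj: "inj (\<lambda>n. M *v n + u)"
    by (auto simp: inj_def)
  have "theta (half_lattice (diag c)) \<alpha> = (\<Prod>i\<in>UNIV. gauss (pi * \<alpha> * (c i)\<^sup>2) (1 / 2))"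
    using c by (rule theta_half_lattice_diag)
  also have "\<dots> \<le> (\<Sum>\<^sub>\<infinity>n\<in>PiE UNIV (\<lambda>_. UNIV). \<Prod>i\<in>UNIV.
      ennreal (exp (- (pi * \<alpha> * (c i)\<^sup>2) * (of_int (n i) + s i n)\<^sup>2)))"
  proof (rule prod_gauss_half_le_triangular)
    show "pi * \<alpha> * (c i)\<^sup>2 > 0" for i
      using c[of i] \<alpha> by simp
    show "s i n = s i m" if "\<And>j. j < i \<Longrightarrow> n j = m j" for i n m
      using that by (simp add: s_def)
  qed simp
  also have "\<dots> = (\<Sum>\<^sub>\<infinity>n. ennreal (exp (- (pi * \<alpha>) * (norm (M *v vec n + u))\<^sup>2)))"
    unfolding norm exp_neg_norm_squared comp
    by (simp add: PiE_UNIV_domain power_mult_distrib mult.assoc)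
  also have "\<dots> = theta ((\<lambda>x. x + u) ` lattice M) \<alpha>"
    using theta_image_int_vecs[OF inj, of \<alpha>] by (simp add: lattice_def image_image vec_def)
  finally show ?thesis .
qed

section \<open>Degenerating diagonal matrices\<close>

text \<open>
  The points of $\mathbb Z+\frac12$ nearest to the origin are $\pm\frac12$, so giving up half of the
  exponent gains the factor $e^{-a/8}$.
\<close>

lemma gauss_half_decay:
  "gauss a (1 / 2) \<le> ennreal (exp (- a / 8)) * gauss (a / 2) (1 / 2)" if a: "a > 0"
proof -
  have "exp (- a * (of_int n + 1 / 2)\<^sup>2) \<le> exp (- a / 8) * exp (- (a / 2) * (of_int n + 1 / 2)\<^sup>2)" for n :: int
  proof -
    have "\<bar>1 / 2\<bar> \<le> \<bar>of_int n + 1 / 2 :: real\<bar>"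
      by (cases "n \<ge> 0") auto
    then have "(1 / 2)\<^sup>2 \<le> (of_int n + 1 / 2 :: real)\<^sup>2"
      by (simp only: abs_le_square_iff)
    then have "1 / 4 \<le> (of_int n + 1 / 2 :: real)\<^sup>2"
      by (simp add: power_divide)
    then have "a / 2 * (1 / 4) \<le> a / 2 * (of_int n + 1 / 2)\<^sup>2"
      using a by (intro mult_left_mono) auto
    then have "- a * (of_int n + 1 / 2)\<^sup>2 \<le> - a / 8 + - (a / 2) * (of_int n + 1 / 2)\<^sup>2"
      by linarith
    then show ?thesis
      by (simp only: exp_le_cancel_iff flip: exp_add)
  qed
  then have "gauss a (1 / 2) \<le>
     (\<Sum>\<^sub>\<infinity>n::int. ennreal (exp (- a / 8)) * ennreal (exp (- (a / 2) * (of_int n + 1 / 2)\<^sup>2)))"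
    unfolding gauss_def by (intro infsum_mono_ennreal) (simp flip: ennreal_mult)
  then show ?thesis
    by (simp add: infsum_cmult_ennreal gauss_def)
qed

text \<open>
  Counting the elements above an index numbers the indices from the top; this identifies the last
  two coordinates in the definition of \<open>A_mat\<close>.
\<close>

lemma card_greaterThan_eq_iff:
  fixes i j :: "'n::{finite,linorder}"
  shows "card {i<..} = card {j<..} \<longleftrightarrow> i = j"
proof -
  have "card {j<..} < card {i<..}" if "i < j" for i j :: 'n
    using that by (intro psubset_card_mono) auto
  then show ?thesis
    by (metis less_irrefl linorder_neqE)
qed

lemma ex_card_greaterThan_eq:
  assumes "k < CARD('n::{finite,linorder})"
  shows "\<exists>i::'n. card {i<..} = k"
proof -
  have "inj (\<lambda>i::'n. card {i<..})"
    by (auto simp: inj_def card_greaterThan_eq_iff)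
  then have "card (range (\<lambda>i::'n. card {i<..})) = card {..<CARD('n)}"
    by (simp add: card_image)
  moreover have "range (\<lambda>i::'n. card {i<..}) \<subseteq> {..<CARD('n)}"
    by (auto intro!: psubset_card_mono)
  ultimately have "range (\<lambda>i::'n. card {i<..}) = {..<CARD('n)}"
    by (intro card_subset_eq) auto
  then show ?thesis using assms by (metis (mono_tags, lifting) imageE lessThan_iff)
qed

text \<open>
  With $b=\pi\alpha$, the factor for the entry $1/k$ grows at most like $k^2$, the factor for the
  entry $k$ is $O(k^{-2}e^{-bk^2/8})$, and the other $d-2$ factors do not depend on $k$.
\<close>

lemma theta_A_mat_tendsto_0:
  assumes d: "CARD('n::{finite,linorder}) \<ge> 2" and \<alpha>: "\<alpha> > 0"
  shows "(\<lambda>k. theta (half_lattice (A_mat k :: real ^ 'n::{finite,linorder} ^ 'n::{finite,linorder})) \<alpha>) \<longlonglongrightarrow> 0"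
proof -
  obtain p q :: 'n where p: "card {p<..} = 0" and q: "card {q<..} = 1"
    using ex_card_greaterThan_eq[of 0, where 'n = 'n] ex_card_greaterThan_eq[of 1, where 'n = 'n] d by auto
  define b where "b = pi * \<alpha>"
  have b: "b > 0" using \<alpha> by (simp add: b_def)
  obtain K where K: "K > 0" "\<And>a. a > 0 \<Longrightarrow> gauss a (1 / 2) \<le> ennreal (K / a)"
    using gauss_half_le by metis
  define C where "C = (K / b) ^ (CARD('n) - 2)"
  have C: "C \<ge> 0" using K b by (simp add: C_def)
  define e where "e = (\<lambda>k::nat. (K * real k ^ 2 / b) * (exp (- (b * real k ^ 2) / 8) * (2 * K / (b * real k ^ 2))) * C)"
  have le: "theta (half_lattice (A_mat k :: real ^ 'n::{finite,linorder} ^ 'n::{finite,linorder})) \<alpha> \<le> ennreal (e k)" if k: "k \<ge> 1" for k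
  proof -
    define c where "c = (\<lambda>i::'n. if i = p then 1 / real k else if i = q then real k else 1)"
    have A: "A_mat k = diag c"
    proof -
      have "card {i<..} = 0 \<longleftrightarrow> i = p" "card {i<..} = 1 \<longleftrightarrow> i = q" for i
        using card_greaterThan_eq_iff[of i p] card_greaterThan_eq_iff[of i q] p q by simp_all
      then show ?thesis unfolding A_mat_def c_def by presburger
    qed
    have "p \<noteq> q" using p q by auto
    have split: "(UNIV :: 'n set) = insert p (insert q (- {p, q}))" by auto
    have "theta (half_lattice (A_mat k :: real ^ 'n::{finite,linorder} ^ 'n::{finite,linorder})) \<alpha> = (\<Prod>i\<in>UNIV. gauss (b * (c i)\<^sup>2) (1 / 2))"
      unfolding A b_def using k by (intro theta_half_lattice_diag) (simp add: c_def)
    also have "\<dots> = gauss (b * (c p)\<^sup>2) (1 / 2) * (gauss (b * (c q)\<^sup>2) (1 / 2) *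
        (\<Prod>i\<in>- {p, q}. gauss (b * (c i)\<^sup>2) (1 / 2)))"
      using \<open>p \<noteq> q\<close> by (subst split) simp
    also have "(\<Prod>i\<in>- {p, q}. gauss (b * (c i)\<^sup>2) (1 / 2)) = gauss b (1 / 2) ^ (CARD('n) - 2)"
    proof -
      have "card (- {p, q}) = CARD('n) - 2"
        using \<open>p \<noteq> q\<close> by (simp add: Compl_eq_Diff_UNIV card_Diff_subset)
      moreover have "(\<Prod>i\<in>- {p, q}. gauss (b * (c i)\<^sup>2) (1 / 2)) = (\<Prod>i\<in>- {p, q}. gauss b (1 / 2))"
        by (intro prod.cong) (auto simp: c_def)
      ultimately show ?thesis by simp
    qed
    also have "gauss (b * (c p)\<^sup>2) (1 / 2) * (gauss (b * (c q)\<^sup>2) (1 / 2) * gauss b (1 / 2) ^ (CARD('n) - 2)) \<le>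
       ennreal (K * real k ^ 2 / b) * ((ennreal (exp (- (b * real k ^ 2) / 8)) * ennreal (2 * K / (b * real k ^ 2))) * ennreal C)"
    proof (intro mult_mono)
      show "gauss (b * (c p)\<^sup>2) (1 / 2) \<le> ennreal (K * real k ^ 2 / b)"
        using K(2)[of "b * (c p)\<^sup>2"] b k by (simp add: c_def power_divide)
      have "gauss (b * (c q)\<^sup>2) (1 / 2) = gauss (b * real k ^ 2) (1 / 2)"
        using \<open>p \<noteq> q\<close> by (simp add: c_def)
      also have "\<dots> \<le> ennreal (exp (- (b * real k ^ 2) / 8)) * gauss (b * real k ^ 2 / 2) (1 / 2)"
        using b k by (intro gauss_half_decay) simp
      also have "\<dots> \<le> ennreal (exp (- (b * real k ^ 2) / 8)) * ennreal (2 * K / (b * real k ^ 2))"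
        using b k K(2)[of "b * real k ^ 2 / 2"] by (intro mult_left_mono) (simp_all add: mult.commute)
      finally show "gauss (b * (c q)\<^sup>2) (1 / 2) \<le> \<dots>" .
      have "gauss b (1 / 2) ^ (CARD('n) - 2) \<le> ennreal (K / b) ^ (CARD('n) - 2)"
        using K(2)[OF b] by (intro power_mono) auto
      then show "gauss b (1 / 2) ^ (CARD('n) - 2) \<le> ennreal C"
        using K b by (simp add: C_def ennreal_power)
    qed auto
    also have "\<dots> = ennreal (e k)"
      using K b C by (simp add: e_def mult.assoc flip: ennreal_mult)
    finally show ?thesis .
  qed
  have "e \<longlonglongrightarrow> 0"
  proof -
    have "filterlim (\<lambda>k. b / 8 * real k ^ 2) at_top sequentially"
      using b by (intro filterlim_tendsto_pos_mult_at_top[OF tendsto_const]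
          filterlim_pow_at_top filterlim_real_sequentially) auto
    then have "(\<lambda>k. exp (- (b / 8 * real k ^ 2))) \<longlonglongrightarrow> 0"
      by (intro filterlim_compose[OF exp_at_bot] filterlim_compose[OF filterlim_uminus_at_bot_at_top])
    then have "(\<lambda>k. 2 * K ^ 2 / b ^ 2 * C * exp (- (b / 8 * real k ^ 2))) \<longlonglongrightarrow> 0"
      by (rule tendsto_mult_right_zero)
    moreover have "eventually (\<lambda>k. 2 * K ^ 2 / b ^ 2 * C * exp (- (b / 8 * real k ^ 2)) = e k) sequentially"
      using eventually_gt_at_top[of 0]
      by eventually_elim (use b in \<open>simp add: e_def field_simps power2_eq_square\<close>)
    ultimately show ?thesis by (rule Lim_transform_eventually)
  qed
  then have lim: "(\<lambda>k. ennreal (e k)) \<longlonglongrightarrow> 0"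
    using tendsto_ennrealI by fastforce
  show ?thesis
    by (rule tendsto_sandwich[OF _ _ tendsto_const lim])
      (use le in \<open>auto intro: eventually_sequentiallyI[of 1]\<close>)
qed

theorem proposition1p3:
  shows "(\<forall>(M :: real ^ 'n::{finite,linorder} ^ 'n::{finite,linorder}) Q T c.
            det M = 1 \<and> rotation_matrix Q \<and> (\<forall>i. c i > 0) \<and> (\<Prod>i\<in>UNIV. c i) = 1 \<and>
            unit_lower_triangular T \<and> M = Q ** diag c ** T \<longrightarrow>
            (\<forall>(u :: real ^ 'n::{finite,linorder}) (\<alpha> :: real). \<alpha> > 0 \<longrightarrow>
               theta ((\<lambda>x. x + u) ` lattice M) \<alpha> \<ge> theta (half_lattice (diag c)) \<alpha>))
       \<and> (CARD('n::{finite,linorder}) \<ge> 2 \<longrightarrow>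
            (\<forall>\<alpha> :: real. \<alpha> > 0 \<longrightarrow>
               (\<lambda>k. theta (half_lattice (A_mat k :: real ^ 'n::{finite,linorder} ^ 'n::{finite,linorder})) \<alpha>) \<longlonglongrightarrow> 0))"
proof (intro conjI allI impI; (elim conjE)?)
  fix M Q T :: "real ^ 'n::{finite,linorder} ^ 'n::{finite,linorder}" and c :: "'n \<Rightarrow> real" and u :: "real ^ 'n::{finite,linorder}" and \<alpha> :: real
  assume "det M = 1" "rotation_matrix Q" "\<forall>i. c i > 0" "unit_lower_triangular T"
    "M = Q ** diag c ** T" "\<alpha> > 0"
  then show "theta (half_lattice (diag c)) \<alpha> \<le> theta ((\<lambda>x. x + u) ` lattice M) \<alpha>"
    by (intro theta_lattice_ge[where Q = Q and T = T]) (auto simp: rotation_matrix_def)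
next
  fix \<alpha> :: real
  assume "CARD('n) \<ge> 2" "\<alpha> > 0"
  then show "(\<lambda>k. theta (half_lattice (A_mat k :: real ^ 'n::{finite,linorder} ^ 'n::{finite,linorder})) \<alpha>) \<longlonglongrightarrow> 0"
    by (rule theta_A_mat_tendsto_0)
qed

end
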